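(* Let $\mathscr{T}=(T_{ijk})\in\mathbb{R}^{3\times 3\times 3}$ be a nonlinear susceptibility tensor, i.e. a real third-order tensor with $T_{ijk}=T_{ikj}$ for all $i,j,k\in\{1,2,3\}$. Let $d_{\text{eff}}^1$ be the maximum of the four-variable model $$d_{\text{eff}}^1=\max\left\{\mathscr{T}\boldsymbol{b}\boldsymbol{a}\boldsymbol{a}:\ a_1^2+a_2^2=1,\ z_1^2+z_2^2=1,\ a_3=0\right\},$$ where $\boldsymbol{a}=(a_1,a_2,a_3)^\top$ and $\boldsymbol{b}=(a_2z_1,-a_1z_1,z_2)^\top$ with $a_1,a_2,z_1,z_2\in\mathbb{R}$. For $i=1,2,3$ put $Q_i(\boldsymbol{a})=\sum_{j,k=1}^2T_{ijk}a_ja_k$. Then the number of variables of this model can be cut in half to $2$, namely $$d_{\text{eff}}^1=\max\left\{\sqrt{\left(a_2Q_1(\boldsymbol{a})-a_1Q_2(\boldsymbol{a})\right)^2+\left(Q_3(\boldsymbol{a})\right)^2}:\ a_1^2+a_2^2=1\right\}.$$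
   Context: For vectors $\boldsymbol{x},\boldsymbol{y},\boldsymbol{w}\in\mathbb{R}^3$, $\mathscr{T}\boldsymbol{x}\boldsymbol{y}\boldsymbol{w}=\sum_{i,j,k=1}^3T_{ijk}x_iy_jw_k$; in particular $\mathscr{T}\boldsymbol{b}\boldsymbol{a}\boldsymbol{a}=\sum_{i,j,k=1}^3T_{ijk}b_ia_ja_k$. A nonlinear (second-order) susceptibility tensor is a real $3\times3\times3$ tensor symmetric in its last two indices (a piezoelectric-type tensor). In uniaxial crystals, $\boldsymbol{a}$ (with $a_3=0$) and $\boldsymbol{b}$ are the unit polarization vectors of the ordinary and extraordinary light; the parametrization $\boldsymbol{b}=(a_2z_1,-a_1z_1,z_2)^\top$ encodes that they are orthogonal. The number $d_{\text{eff}}^1$ is a largest effective second-harmonic generation (SHG) coefficient. *)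

theory Defs
  imports "HOL-Analysis.Analysis"
begin

text \<open>The entry \<open>T\<^sub>i\<^sub>j\<^sub>k\<close> is \<open>T $ i $ j $ k\<close>. In the index type \<open>3\<close> the numerals \<open>1\<close>, \<open>2\<close>, \<open>3\<close> are its
  three distinct elements (with \<open>3 = 0\<close>).\<close>

type_synonym tensor3 = "real ^ 3 ^ 3 ^ 3"

definition nonlinear_susceptibility :: "tensor3 \<Rightarrow> bool" where
  "nonlinear_susceptibility T \<longleftrightarrow> (\<forall>i j k. T $ i $ j $ k = T $ i $ k $ j)"

definition tensor_form :: "tensor3 \<Rightarrow> real ^ 3 \<Rightarrow> real ^ 3 \<Rightarrow> real ^ 3 \<Rightarrow> real" where
  "tensor_form T x y w =
     (\<Sum>i\<in>UNIV. \<Sum>j\<in>UNIV. \<Sum>k\<in>UNIV. T $ i $ j $ k * x $ i * y $ j * w $ k)"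

definition Q :: "tensor3 \<Rightarrow> 3 \<Rightarrow> real ^ 3 \<Rightarrow> real" where
  "Q T i a = (\<Sum>j\<in>{1, 2}. \<Sum>k\<in>{1, 2}. T $ i $ j $ k * a $ j * a $ k)"

definition is_maximum :: "real set \<Rightarrow> real \<Rightarrow> bool" where
  "is_maximum S m \<longleftrightarrow> m \<in> S \<and> (\<forall>v\<in>S. v \<le> m)"

definition ordinary :: "real \<Rightarrow> real \<Rightarrow> real ^ 3" where
  "ordinary a1 a2 = vector [a1, a2, 0]"

definition extraordinary :: "real \<Rightarrow> real \<Rightarrow> real \<Rightarrow> real \<Rightarrow> real ^ 3" where
  "extraordinary a1 a2 z1 z2 = vector [a2 * z1, - a1 * z1, z2]"

definition four_variable_values :: "tensor3 \<Rightarrow> real set" where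
  "four_variable_values T =
     {tensor_form T (extraordinary a1 a2 z1 z2) (ordinary a1 a2) (ordinary a1 a2) | a1 a2 z1 z2.
        a1\<^sup>2 + a2\<^sup>2 = 1 \<and> z1\<^sup>2 + z2\<^sup>2 = 1}"

definition two_variable_values :: "tensor3 \<Rightarrow> real set" where
  "two_variable_values T =
     {sqrt ((a2 * Q T 1 (ordinary a1 a2) - a1 * Q T 2 (ordinary a1 a2))\<^sup>2
            + (Q T 3 (ordinary a1 a2))\<^sup>2) | a1 a2.
        a1\<^sup>2 + a2\<^sup>2 = 1}"

text \<open>\<open>Greatest\<close> is a definite description, so this is meaningful only where the maximum is
  attained; \<open>is_maximum (four_variable_values T) (d_eff1 T)\<close> asserts that it is.\<close>

definition d_eff1 :: "tensor3 \<Rightarrow> real" where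
  "d_eff1 T = (GREATEST v. v \<in> four_variable_values T)"

end

theory Submission
  imports Defs
begin

text \<open>For a fixed ordinary direction \<open>a = (a\<^sub>1, a\<^sub>2, 0)\<close> the effective coefficient is linear in
  \<open>z = (z\<^sub>1, z\<^sub>2)\<close>: it is the inner product of \<open>z\<close> with
  \<open>(a\<^sub>2 Q\<^sub>1(a) - a\<^sub>1 Q\<^sub>2(a), Q\<^sub>3(a))\<close>. By the Cauchy--Schwarz inequality its maximum over the unit
  circle is the norm of that vector, which is the two-variable objective. Maximizing over \<open>z\<close> first
  therefore eliminates \<open>z\<close>, and a maximum of the two-variable model is also one of the
  four-variable model (\<open>is_maximum_four_if_two\<close>). The two-variable maximum is attained because its
  objective is continuous on the compact unit circle (\<open>two_variable_maximum_exists\<close>).\<close>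

lemma Q_ordinary:
  "Q T i (ordinary a1 a2) =
     T $ i $ 1 $ 1 * a1 * a1 + T $ i $ 1 $ 2 * a1 * a2 + T $ i $ 2 $ 1 * a2 * a1
       + T $ i $ 2 $ 2 * a2 * a2"
  by (simp add: Q_def ordinary_def)

text \<open>All terms with \<open>j = 3\<close> or \<open>k = 3\<close> vanish because the third component of the ordinary
  vector is zero; what remains are the quadratic forms \<open>Q\<^sub>i\<close> weighted by the components of the
  extraordinary vector.\<close>

lemma tensor_form_polarization:
  "tensor_form T (extraordinary a1 a2 z1 z2) (ordinary a1 a2) (ordinary a1 a2) =
     (a2 * Q T 1 (ordinary a1 a2) - a1 * Q T 2 (ordinary a1 a2)) * z1
       + Q T 3 (ordinary a1 a2) * z2"
  unfolding Q_ordinary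
  by (simp add: tensor_form_def sum_3 ordinary_def extraordinary_def algebra_simps)

text \<open>Cauchy--Schwarz in the plane, via Lagrange's identity
  \<open>(p\<^sup>2 + q\<^sup>2) (z\<^sub>1\<^sup>2 + z\<^sub>2\<^sup>2) = (p z\<^sub>1 + q z\<^sub>2)\<^sup>2 + (p z\<^sub>2 - q z\<^sub>1)\<^sup>2\<close>.\<close>

lemma linear_form_le_norm_on_circle:
  fixes p q z1 z2 :: real
  assumes "z1\<^sup>2 + z2\<^sup>2 = 1"
  shows "p * z1 + q * z2 \<le> sqrt (p\<^sup>2 + q\<^sup>2)"
proof (rule real_le_rsqrt)
  have "p\<^sup>2 + q\<^sup>2 = (p\<^sup>2 + q\<^sup>2) * (z1\<^sup>2 + z2\<^sup>2)"
    using assms by simp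
  also have "\<dots> = (p * z1 + q * z2)\<^sup>2 + (p * z2 - q * z1)\<^sup>2"
    by algebra
  finally show "(p * z1 + q * z2)\<^sup>2 \<le> p\<^sup>2 + q\<^sup>2"
    by simp
qed

lemma linear_form_attains_norm_on_circle:
  fixes p q :: real
  obtains z1 z2 where "z1\<^sup>2 + z2\<^sup>2 = 1" "p * z1 + q * z2 = sqrt (p\<^sup>2 + q\<^sup>2)"
proof (cases "p\<^sup>2 + q\<^sup>2 = 0")
  case True
  \<comment> \<open>The form vanishes identically, so any point of the circle serves.\<close>
  then show ?thesis
    using that[of 1 0] by (simp add: sum_power2_eq_zero_iff)
next
  case False
  define r where "r = sqrt (p\<^sup>2 + q\<^sup>2)"
  have r: "r\<^sup>2 = p\<^sup>2 + q\<^sup>2" "r \<noteq> 0"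
    using False by (simp_all add: r_def)
  have "(p / r)\<^sup>2 + (q / r)\<^sup>2 = (p\<^sup>2 + q\<^sup>2) / r\<^sup>2"
    by (simp add: power_divide add_divide_distrib)
  then have circle: "(p / r)\<^sup>2 + (q / r)\<^sup>2 = 1"
    using False by (simp add: r(1))
  have "p * (p / r) + q * (q / r) = (p\<^sup>2 + q\<^sup>2) / r"
    by (simp add: power2_eq_square add_divide_distrib)
  also have "\<dots> = r"
    unfolding r(1)[symmetric] by (simp add: power2_eq_square)
  finally show ?thesis
    using that circle by (simp add: r_def)
qed

lemma is_maximum_four_if_two:
  assumes "is_maximum (two_variable_values T) m"
  shows "is_maximum (four_variable_values T) m"
proof -
  define p where "p a1 a2 = a2 * Q T 1 (ordinary a1 a2) - a1 * Q T 2 (ordinary a1 a2)" for a1 a2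
  define q where "q a1 a2 = Q T 3 (ordinary a1 a2)" for a1 a2
  have two: "two_variable_values T = {sqrt ((p a1 a2)\<^sup>2 + (q a1 a2)\<^sup>2) | a1 a2. a1\<^sup>2 + a2\<^sup>2 = 1}"
    by (simp add: two_variable_values_def p_def q_def)
  have four: "four_variable_values T =
      {p a1 a2 * z1 + q a1 a2 * z2 | a1 a2 z1 z2. a1\<^sup>2 + a2\<^sup>2 = 1 \<and> z1\<^sup>2 + z2\<^sup>2 = 1}"
    by (simp add: four_variable_values_def tensor_form_polarization p_def q_def)
  obtain a1 a2 where a: "a1\<^sup>2 + a2\<^sup>2 = 1" "m = sqrt ((p a1 a2)\<^sup>2 + (q a1 a2)\<^sup>2)"
    using assms by (auto simp: is_maximum_def two)
  obtain z1 z2 where z: "z1\<^sup>2 + z2\<^sup>2 = 1" "p a1 a2 * z1 + q a1 a2 * z2 = m"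
    using linear_form_attains_norm_on_circle[of "p a1 a2" "q a1 a2"] a(2) by metis
  have "m \<in> four_variable_values T"
    unfolding four using a(1) z by blast
  moreover have "v \<le> m" if "v \<in> four_variable_values T" for v
  proof -
    from that obtain b1 b2 y1 y2 where
      v: "v = p b1 b2 * y1 + q b1 b2 * y2" and b: "b1\<^sup>2 + b2\<^sup>2 = 1" and y: "y1\<^sup>2 + y2\<^sup>2 = 1"
      unfolding four by blast
    have "v \<le> sqrt ((p b1 b2)\<^sup>2 + (q b1 b2)\<^sup>2)"
      unfolding v using y by (rule linear_form_le_norm_on_circle)
    also have "\<dots> \<le> m"
      using assms b unfolding is_maximum_def two by blast
    finally show ?thesis .
  qed
  ultimately show ?thesis
    by (simp add: is_maximum_def)
qed

lemma two_variable_maximum_exists: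
  obtains m where "is_maximum (two_variable_values T) m"
proof -
  define f where "f = (\<lambda>(a1, a2). sqrt ((a2 * Q T 1 (ordinary a1 a2) - a1 * Q T 2 (ordinary a1 a2))\<^sup>2
            + (Q T 3 (ordinary a1 a2))\<^sup>2))"
  have image: "two_variable_values T = f ` sphere 0 1"
    by (force simp: two_variable_values_def f_def norm_Pair image_iff)
  have "continuous_on (sphere 0 1) f"
    unfolding f_def Q_ordinary case_prod_unfold by (intro continuous_intros)
  moreover have "(1, 0) \<in> (sphere 0 1 :: (real \<times> real) set)"
    by (simp add: norm_Pair)
  ultimately obtain x where "x \<in> sphere 0 1" "\<And>y. y \<in> sphere 0 1 \<Longrightarrow> f y \<le> f x"
    using continuous_attains_sup[of "sphere 0 1" f] by auto
  then have "is_maximum (two_variable_values T) (f x)"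
    by (auto simp: is_maximum_def image)
  then show ?thesis
    by (rule that)
qed

theorem theorem3p1:
  fixes T :: tensor3
  assumes "nonlinear_susceptibility T"
  shows "is_maximum (four_variable_values T) (d_eff1 T) \<and>
         is_maximum (two_variable_values T) (d_eff1 T)"
proof -
  obtain m where two: "is_maximum (two_variable_values T) m"
    by (rule two_variable_maximum_exists)
  then have four: "is_maximum (four_variable_values T) m"
    by (rule is_maximum_four_if_two)
  then have "d_eff1 T = m"
    unfolding d_eff1_def is_maximum_def by (intro Greatest_equality) auto
  with two four show ?thesis
    by simp
qed

end
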